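(* Let $f:\mathbb{N}\to\mathbb{N}$ satisfy $f(n)\to\infty$ as $n\to\infty$. Suppose that for every integer $d\ge0$, $\lim_{k\to\infty} M_{f,k}(d) = L_f(d)$, and that $f(n+1) < \frac{3}{2} f(n)$ for all sufficiently large $n$. Then \[ N_{f,d} \geq \lfloor \log_2(d) \rfloor + 1 \] for all sufficiently large $d$.
   Context: $\mathbb{N}=\{1,2,3,\dots\}$. $\Delta_{f,k}(n) := \min\{|f(n) - m^k| : m \in \mathbb{Z}\}$. For $d\ge0$: $M_{f,k}(d) := \max\{n \in \mathbb{N} : \Delta_{f,k}(n) \le d\}$ (or $\infty$ if no maximum exists); $L_f(d) := \max\{n\in\mathbb{N} : f(n) \le d+1\}$ (or $\infty$ if no maximum exists); and $N_{f,d} := \min\{ n \in \mathbb{N} : M_{f,k}(d) = L_f(d) \text{ for all } k \geq n \}$. *)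

theory Defs
  imports "HOL-Library.Extended_Real"
begin

text \<open>
  Functions from the positive integers to the positive integers are modelled as
  \<^typ>\<open>nat \<Rightarrow> nat\<close>; only the values at arguments \<open>n \<ge> 1\<close> are used below.
\<close>

(* The infimum of a nonempty set of naturals is its minimum. *)
definition Delta :: "(nat \<Rightarrow> nat) \<Rightarrow> nat \<Rightarrow> nat \<Rightarrow> nat" where
  "Delta f k n = (INF m::int. nat \<bar>int (f n) - m ^ k\<bar>)"

(* A set of naturals has a maximum iff it is finite and nonempty; in particular
   the value is \<infinity> for the empty set as well. *)
definition max_or_infty :: "nat set \<Rightarrow> enat" where
  "max_or_infty S = (if finite S \<and> S \<noteq> {} then enat (Max S) else \<infinity>)"

definition M :: "(nat \<Rightarrow> nat) \<Rightarrow> nat \<Rightarrow> nat \<Rightarrow> enat" where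
  "M f k d = max_or_infty {n. n \<ge> 1 \<and> Delta f k n \<le> d}"

definition L :: "(nat \<Rightarrow> nat) \<Rightarrow> nat \<Rightarrow> enat" where
  "L f d = max_or_infty {n. n \<ge> 1 \<and> f n \<le> d + 1}"

definition N :: "(nat \<Rightarrow> nat) \<Rightarrow> nat \<Rightarrow> nat" where
  "N f d = (LEAST n. n \<ge> 1 \<and> (\<forall>k\<ge>n. M f k d = L f d))"

end

theory Submission
  imports Defs
begin

text \<open>
  Put \<open>K = \<lfloor>log\<^sub>2 d\<rfloor>\<close> and \<open>l = L\<^sub>f(d)\<close>. For large \<open>d\<close> also \<open>l\<close> is large, so
  \<open>d + 1 < f(l + 1) < 3/2 (d + 1)\<close>. Since \<open>(d + 1)/2 \<le> 2\<^sup>K \<le> d\<close>, the power \<open>2\<^sup>K\<close> is within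
  distance \<open>d\<close> of \<open>f(l + 1)\<close>; hence \<open>M\<^bsub>f,K\<^esub>(d) > L\<^sub>f(d)\<close>, that is, \<open>N\<^bsub>f,d\<^esub> > K\<close>.
\<close>

lemma Delta_le: "Delta f k n \<le> nat \<bar>int (f n) - m ^ k\<bar>"
  unfolding Delta_def by (rule cINF_lower) auto

text \<open>For infinite \<open>S\<close> the right-hand side is \<open>\<infinity>\<close>, so the
  bound also covers an infinite \<open>M f k d\<close>.\<close>

lemma max_or_infty_ge: "n \<in> S \<Longrightarrow> enat n \<le> max_or_infty S"
  by (simp add: max_or_infty_def)

lemma finite_sublevel_of_filterlim_at_top:
  fixes f :: "nat \<Rightarrow> nat"
  assumes "filterlim f at_top sequentially"
  shows "finite {n. f n \<le> c}"
proof -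
  have "\<forall>\<^sub>F n in sequentially. c < f n"
    using assms unfolding filterlim_at_top less_eq_Suc_le by blast
  then obtain n0 where "\<And>n. n \<ge> n0 \<Longrightarrow> c < f n"
    unfolding eventually_sequentially by blast
  then have "{n. f n \<le> c} \<subseteq> {..<n0}"
    by (auto simp flip: not_le)
  then show ?thesis
    using finite_subset by blast
qed

text \<open>Finite points of \<open>enat\<close> are isolated: \<open>{enat l}\<close> is an open
  neighbourhood of the limit.\<close>

lemma eventually_eq_of_tendsto_enat:
  fixes g :: "'a \<Rightarrow> enat"
  assumes "(g \<longlongrightarrow> enat l) F"
  shows "\<forall>\<^sub>F k in F. g k = enat l"
  using topological_tendstoD[OF assms, of "{enat l}"] open_enat by auto

text \<open>Convergence to a finite limit forces eventual equality, so the \<open>LEAST\<close> in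
  \<open>N\<close> ranges over a nonempty set and attains its defining property.\<close>

lemma N_spec:
  assumes "(\<lambda>k. M f k d) \<longlonglongrightarrow> L f d" "L f d = enat l" "k \<ge> N f d"
  shows "M f k d = L f d"
proof -
  have "\<forall>\<^sub>F k in sequentially. M f k d = L f d"
    using eventually_eq_of_tendsto_enat assms(1) unfolding assms(2) .
  then obtain n where "\<And>k. k \<ge> n \<Longrightarrow> M f k d = L f d"
    unfolding eventually_sequentially by blast
  then have "max n 1 \<ge> 1 \<and> (\<forall>k\<ge>max n 1. M f k d = L f d)"
    by auto
  from LeastI[of "\<lambda>n. n \<ge> 1 \<and> (\<forall>k\<ge>n. M f k d = L f d)", OF this] assms(3)
  show ?thesis unfolding N_def by blast
qed

theorem theorem4p1:
  fixes f :: "nat \<Rightarrow> nat"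
  assumes "\<And>n. n \<ge> 1 \<Longrightarrow> f n \<ge> 1"
    and "filterlim f at_top sequentially"
    and "\<And>d. (\<lambda>k. M f k d) \<longlonglongrightarrow> L f d"
    and "\<forall>\<^sub>F n in sequentially. real (f (n + 1)) < 3 / 2 * real (f n)"
  shows "\<forall>\<^sub>F d in sequentially. int (N f d) \<ge> \<lfloor>log 2 (real d)\<rfloor> + 1"
proof -
  obtain n0 where n0: "\<And>n. n \<ge> n0 \<Longrightarrow> real (f (n + 1)) < 3 / 2 * real (f n)"
    using assms(4) unfolding eventually_sequentially by blast
  define n1 where "n1 = max n0 1"
  \<comment> \<open>The bound \<open>f n1 \<le> d\<close> puts \<open>n1\<close> into the set
    \<open>S\<close> below, so its maximum is at least \<open>n0\<close> and the growth hypothesis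
    applies there; \<open>d \<ge> 1\<close> makes the logarithm nonnegative.\<close>
  have "int (N f d) \<ge> \<lfloor>log 2 (real d)\<rfloor> + 1" if d: "d \<ge> max 1 (f n1)" for d
  proof -
    define S where "S = {n. n \<ge> 1 \<and> f n \<le> d + 1}"
    define l where "l = Max S"
    have fin: "finite S"
      using finite_sublevel_of_filterlim_at_top[OF assms(2), of "d + 1"]
      by (rule rev_finite_subset) (auto simp: S_def)
    have "n1 \<in> S"
      using d by (auto simp: S_def n1_def)
    then have Ll: "L f d = enat l"
      using fin by (auto simp: L_def max_or_infty_def S_def l_def)
    have "l \<ge> n1"
      using \<open>n1 \<in> S\<close> fin by (simp add: l_def)
    have "l \<in> S"
      unfolding l_def using \<open>n1 \<in> S\<close> by (intro Max_in[OF fin]) blast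
    have "Suc l \<notin> S"
      using Max_ge[OF fin, of "Suc l"] by (auto simp: l_def)
    then have f_lower: "f (l + 1) > d + 1"
      by (auto simp: S_def)
    have f_upper: "2 * f (l + 1) < 3 * (d + 1)"
      using n0[of l] \<open>l \<ge> n1\<close> \<open>l \<in> S\<close> unfolding n1_def S_def by simp
    define K where "K = nat \<lfloor>log 2 (real d)\<rfloor>"
    have K: "int K = \<lfloor>log 2 (real d)\<rfloor>"
      using d by (simp add: K_def)
    then have "2 ^ K \<le> d" "d < 2 ^ (K + 1)"
      using d floor_log_nat_eq_powr_iff[of 2 d K] by auto
    then have "int (2 ^ K) \<le> int d" "int d + 1 \<le> 2 * int (2 ^ K)"
      by (simp_all del: of_nat_power)
    \<comment> \<open>The difference is positive, and twice it is less than
      \<open>3 * (d + 1) - (d + 1) = 2 * (d + 1)\<close>.\<close>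
    then have "nat \<bar>int (f (l + 1)) - 2 ^ K\<bar> \<le> d"
      using f_lower f_upper by simp
    then have "Delta f K (l + 1) \<le> d"
      using Delta_le order_trans by blast
    then have "enat (l + 1) \<le> M f K d"
      unfolding M_def by (intro max_or_infty_ge) simp
    then have "M f K d \<noteq> L f d"
      by (auto simp: Ll)
    \<comment> \<open>By \<open>N_spec\<close>, \<open>K \<ge> N f d\<close> would force
      equality.\<close>
    then have "K < N f d"
      using N_spec[OF assms(3) Ll] linorder_not_le by blast
    then show ?thesis
      using K by linarith
  qed
  then show ?thesis
    unfolding eventually_sequentially by blast
qed

end
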